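(* Let $(S,\Sigma)$ be a measurable space, $f:\mathbb X\to S$ measurable, and suppose that for all $y\ne e$, or more generally for $\mathbf E^{\mathfrak m}[\mathfrak m^!]$-a.e. $y\in\mathbb X$, $$\lambda(\{x\in\mathbb X:f(x)=f(xy)\})=0.$$ Then $f$ separates points of $\mathfrak m$, i.e. $\mathbf P$-a.s. no two distinct $X,Y\in\mathfrak m$ have $f(X)=f(Y)$. Implicit here is the assumption that the sets $\{x\in\mathbb X:f(x)=f(xy)\}$ are measurable for all $y\in\mathbb X$; this is automatic if $(S,\Sigma)$ is a standard measurable space, or more generally if $S\times S$ has measurable diagonal.
   Context: $\mathbb X$ is a locally compact second-countable Hausdorff topological group with neutral element $e$, Borel sets $\mathcal B(\mathbb X)$ and a fixed left-invariant Haar measure $\lambda$. $(\Omega,\mathcal A,\theta,\mathbf P)$ is a stationary framework on $\mathbb X$: $(\Omega,\mathcal A,\mathbf P)$ is a probability space and $\theta:\mathbb X\times\Omega\to\Omega$, $\theta_x\omega:=\theta(x,\omega)$, is a (jointly) measurable left action of $\mathbb X$ preserving $\mathbf P$. $\mathfrak m$ is a simple point process (random locally finite counting measure on $\mathbb X$ with all atoms of mass $1$, identified with its support) that is flow-adapted: $\mathfrak m(\theta_x\omega,B)=\mathfrak m(\omega,x^{-1}B)$ for all $x\in\mathbb X,\omega\in\Omega,B\in\mathcal B(\mathbb X)$; its intensity $\gamma=\mathbf E[\mathfrak m(B)]/\lambda(B)$ (for any $B$ with $\lambda(B)\in(0,\infty)$) lies in $(0,\infty)$. The Palm probability measure is $\mathbf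 P^{\mathfrak m}(A):=\frac1\gamma\mathbf E\int_{\mathbb X}1_{\theta_x^{-1}\omega\in A}w(x)\,\mathfrak m(dx)$ for $A\in\mathcal A$, for any measurable $w:\mathbb X\to[0,\infty)$ with $\int w\,d\lambda=1$ (the choice of $w$ does not matter); $\mathbf E^{\mathfrak m}$ is expectation under it, and $e\in\mathfrak m$ holds $\mathbf P^{\mathfrak m}$-a.s. Under $\mathbf P^{\mathfrak m}$, $\mathfrak m^!:=\mathfrak m-\delta_e$, and $\mathbf E^{\mathfrak m}[\mathfrak m^!]$ is the measure $B\mapsto\mathbf E^{\mathfrak m}[\mathfrak m^!(B)]$.
   Formalization: Measurability of each set {x : f(x)=f(xy)} is strengthened to joint measurability of {(x,y) : f(x)=f(xy)}, since sectionwise measurability does not suffice for general S; the joint form is proved automatic when S×S has measurable diagonal, in particular for standard S. *)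

theory Defs
  imports "HOL-Probability.Probability"
begin

text \<open>
  The group is written additively, because the library class \<open>topological_group_add\<close> is the class of
  topological groups; it does \<^emph>\<open>not\<close> assume commutativity.  So \<open>x + y\<close> stands for \<open>xy\<close>, \<open>- x\<close> for
  \<open>x\<^sup>-\<^sup>1\<close> and \<open>0\<close> for the neutral element \<open>e\<close>.
\<close>

text \<open>On a locally compact second-countable Hausdorff group every Borel measure that is finite on
  compact sets is regular, so regularity is not listed.\<close>

definition left_Haar_measure :: "'a::topological_group_add measure \<Rightarrow> bool" where
  "left_Haar_measure \<mu> \<longleftrightarrow>
     sets \<mu> = sets borel \<and>
     emeasure \<mu> UNIV \<noteq> 0 \<and>
     (\<forall>K. compact K \<longrightarrow> emeasure \<mu> K < \<infinity>) \<and>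
     (\<forall>x. \<forall>B\<in>sets borel. emeasure \<mu> ((\<lambda>y. x + y) ` B) = emeasure \<mu> B)"

definition stationary_framework ::
  "'w measure \<Rightarrow> ('a::topological_group_add \<Rightarrow> 'w \<Rightarrow> 'w) \<Rightarrow> bool" where
  "stationary_framework P \<theta> \<longleftrightarrow>
     prob_space P \<and>
     (\<lambda>(x, \<omega>). \<theta> x \<omega>) \<in> borel \<Otimes>\<^sub>M P \<rightarrow>\<^sub>M P \<and>
     (\<forall>\<omega>\<in>space P. \<theta> 0 \<omega> = \<omega>) \<and>
     (\<forall>x y. \<forall>\<omega>\<in>space P. \<theta> (x + y) \<omega> = \<theta> x (\<theta> y \<omega>)) \<and>
     (\<forall>x. distr P P (\<theta> x) = P)"

definition simple_counting_measure :: "'a::topological_space measure \<Rightarrow> bool" where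
  "simple_counting_measure \<mu> \<longleftrightarrow>
     sets \<mu> = sets borel \<and>
     (\<forall>K. compact K \<longrightarrow> emeasure \<mu> K < \<infinity>) \<and>
     (\<forall>B\<in>sets borel. emeasure \<mu> B = \<infinity> \<or> (\<exists>n::nat. emeasure \<mu> B = of_nat n)) \<and>
     (\<forall>x. emeasure \<mu> {x} \<le> 1)"

text \<open>The set of atoms; for a simple counting measure this is its support.\<close>

definition points :: "'a measure \<Rightarrow> 'a set" where
  "points \<mu> = {x. emeasure \<mu> {x} \<noteq> 0}"

definition simple_point_process ::
  "'w measure \<Rightarrow> ('w \<Rightarrow> 'a::topological_space measure) \<Rightarrow> bool" where
  "simple_point_process P \<mm> \<longleftrightarrow>
     (\<forall>\<omega>\<in>space P. simple_counting_measure (\<mm> \<omega>)) \<and>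
     (\<forall>B\<in>sets borel. (\<lambda>\<omega>. emeasure (\<mm> \<omega>) B) \<in> borel_measurable P)"

definition flow_adapted ::
  "'w measure \<Rightarrow> ('a::topological_group_add \<Rightarrow> 'w \<Rightarrow> 'w) \<Rightarrow> ('w \<Rightarrow> 'a measure) \<Rightarrow> bool" where
  "flow_adapted P \<theta> \<mm> \<longleftrightarrow>
     (\<forall>x. \<forall>\<omega>\<in>space P. \<forall>B\<in>sets borel.
        emeasure (\<mm> (\<theta> x \<omega>)) B = emeasure (\<mm> \<omega>) ((\<lambda>y. - x + y) ` B))"

text \<open>The intensity computed from the test set \<open>B\<close>.  In the stationary situation the value is the same
  for all \<open>B\<close> with positive finite Haar measure; this is not built into the definition.\<close>

definition intensity ::
  "'w measure \<Rightarrow> 'a measure \<Rightarrow> ('w \<Rightarrow> 'a measure) \<Rightarrow> 'a set \<Rightarrow> ennreal" where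
  "intensity P haar \<mm> B = (\<integral>\<^sup>+\<omega>. emeasure (\<mm> \<omega>) B \<partial>P) / emeasure haar B"

text \<open>The Palm measure of \<open>\<mm>\<close> computed with weight \<open>w\<close> and intensity \<open>\<gamma>\<close>, using
  \<open>\<theta>\<^sub>x\<^sup>-\<^sup>1 = \<theta> (- x)\<close>.\<close>

definition palm_measure ::
  "'w measure \<Rightarrow> ('a::group_add \<Rightarrow> 'w \<Rightarrow> 'w) \<Rightarrow> ('w \<Rightarrow> 'a measure) \<Rightarrow> ennreal \<Rightarrow> ('a \<Rightarrow> real)
     \<Rightarrow> 'w measure" where
  "palm_measure P \<theta> \<mm> \<gamma> w =
     measure_of (space P) (sets P)
       (\<lambda>A. (\<integral>\<^sup>+\<omega>. (\<integral>\<^sup>+x. indicator A (\<theta> (- x) \<omega>) * ennreal (w x) \<partial>\<mm> \<omega>) \<partial>P) / \<gamma>)"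

text \<open>\<open>\<mm>\<^sup>! = \<mm> - \<delta>\<^sub>e\<close>.  Only meaningful where \<open>0\<close> is a point of \<open>\<mm> \<omega>\<close>, which is almost everywhere
  under the Palm measure.\<close>

definition reduced_process :: "('w \<Rightarrow> 'a::{zero,topological_space} measure) \<Rightarrow> 'w \<Rightarrow> 'a measure" where
  "reduced_process \<mm> \<omega> = diff_measure (\<mm> \<omega>) (return borel 0)"

definition mean_measure :: "'w measure \<Rightarrow> ('w \<Rightarrow> 'a::topological_space measure) \<Rightarrow> 'a measure" where
  "mean_measure Q \<xi> = measure_of UNIV (sets borel) (\<lambda>B. \<integral>\<^sup>+\<omega>. emeasure (\<xi> \<omega>) B \<partial>Q)"

definition separates_points_of :: "('a \<Rightarrow> 's) \<Rightarrow> 'w measure \<Rightarrow> ('w \<Rightarrow> 'a measure) \<Rightarrow> bool" where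
  "separates_points_of f P \<mm> \<longleftrightarrow>
     (AE \<omega> in P. \<not> (\<exists>X\<in>points (\<mm> \<omega>). \<exists>Y\<in>points (\<mm> \<omega>). X \<noteq> Y \<and> f X = f Y))"

definition measurable_diagonal :: "'s measure \<Rightarrow> bool" where
  "measurable_diagonal S \<longleftrightarrow> {(s, s) |s. s \<in> space S} \<in> sets (S \<Otimes>\<^sub>M S)"

definition standard_measurable_space :: "'s measure \<Rightarrow> bool" where
  "standard_measurable_space S \<longleftrightarrow>
     (\<exists>T. completely_metrizable_space T \<and> second_countable T \<and>
          topspace T = space S \<and> sets S = sigma_sets (topspace T) {U. openin T U})"

text \<open>The coincidence sets \<open>{x. f x = f (xy)}\<close> depend measurably on \<open>y\<close>, i.e. they are the sections of a
  measurable subset of the product.  Measurability of each single section is not enough for an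
  almost-sure statement about pairs of points: for the reals, a transfinite construction gives an \<open>f\<close>
  (measurable for the trivial \<open>\<sigma>\<close>-algebra) all of whose coincidence sets for \<open>y \<noteq> 0\<close> have at most two
  elements, while \<open>{(x, z). x \<noteq> z \<and> f x = f z}\<close> meets every closed plane set of positive Lebesgue
  measure; a Poisson process is then not separated by \<open>f\<close>.\<close>

definition measurable_coincidences :: "('a::{plus,topological_space} \<Rightarrow> 's) \<Rightarrow> bool" where
  "measurable_coincidences f \<longleftrightarrow> {(x, y). f x = f (x + y)} \<in> sets (borel \<Otimes>\<^sub>M borel)"

end

theory Submission
  imports Defs
begin

text \<open>Write \<open>N y = {x. f x = f (x + y)}\<close>.  A pair of distinct points \<open>X\<close>, \<open>Y\<close> of the process is not separated
by \<open>f\<close> exactly if \<open>X \<in> N y\<close> for the displacement \<open>y = - X + Y\<close>.  Re-centring the configuration at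
\<open>X\<close> makes \<open>y\<close> a point of the re-centred configuration, and the refined Campbell theorem says that the
position \<open>X\<close>, distributed according to Haar measure, is independent of the re-centred configuration,
distributed according to the Palm measure.  So the expected number of bad pairs is the intensity
times the integral of \<open>haar (N y)\<close> over \<open>y\<close> with respect to the Palm mean of the reduced process,
and this is zero by hypothesis.

The usual proof of the refined Campbell theorem rests on the uniqueness of Haar measure up to a
constant.  Only a statement about null sets is needed here, and it has a direct proof.  The lemma
\<open>weight_exchange\<close> averages stationarity over all shifts by Fubini's theorem.  It relates the
expectation over all points to the weighted expectation that occurs in the definition of the Palm
measure.  The price is a right translation inside an integral with respect to Haar measure, which is
harmless because null sets of a left-invariant measure are also invariant under reflections and
right translations (\<open>nn_integral_haar_reflect_eq_0\<close>).  The conclusion for an arbitrary measurable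
relation between position and displacement is \<open>AE_no_related_points\<close>.

It remains to connect this with the measures in the statement.  The Palm measure and the mean
measure are shown to be the mixtures that their definitions suggest, and the neutral element is
shown to be a point of the process almost surely under the Palm measure.  The latter uses that an
integer-valued locally finite measure on a second-countable locally compact Hausdorff space is
carried by its atoms.  The claims about measurability follow because coincidences are the preimage
of the diagonal under \<open>(x, y) \<mapsto> (f x, f (x + y))\<close>, and the diagonal of a second-countable Hausdorff
space is the complement of a countable union of open rectangles.\<close>

section \<open>Borel measurability in topological groups\<close>

lemma borel_measurable_group_uminus [measurable (raw)]:
  fixes g :: "'b \<Rightarrow> 'a::{topological_group_add, second_countable_topology}"
  assumes "g \<in> borel_measurable M"
  shows "(\<lambda>x. - g x) \<in> borel_measurable M"
  by (rule borel_measurable_continuous_on[OF _ assms])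
     (auto simp: continuous_on_def intro!: tendsto_minus tendsto_ident_at)

text \<open>Left invariance and flow-adaptedness speak of images under translations, whereas push-forward
measures are computed from preimages.\<close>

lemma image_plus_eq_vimage:
  fixes a :: "'a::group_add"
  shows "(\<lambda>y. - a + y) ` B = (\<lambda>y. a + y) -` B"
proof -
  have "y \<in> (\<lambda>y. - a + y) ` B" if "a + y \<in> B" for y
    using that by (intro image_eqI[where x="a + y"]) (simp_all add: add.assoc[symmetric])
  then show ?thesis by (auto simp add: add.assoc[symmetric])
qed

section \<open>Locally finite measures on locally compact spaces\<close>

lemma compact_neighbourhood:
  assumes "locally_compact_space (euclidean :: 'a::topological_space topology)"
  obtains U K :: "'a::topological_space set" where "open U" "compact K" "x \<in> U" "U \<subseteq> K"
proof -
  have "x \<in> topspace euclidean" by simp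
  then obtain U K where "openin euclidean U" "compactin euclidean K" "x \<in> U" "U \<subseteq> K"
    using assms unfolding locally_compact_space_def by meson
  then show ?thesis by (intro that[of U K]) auto
qed

lemma countable_compact_cover:
  assumes "locally_compact_space (euclidean :: 'a::second_countable_topology topology)"
  obtains K :: "nat \<Rightarrow> 'a::second_countable_topology set" where "\<And>n. compact (K n)" "(\<Union>n. K n) = UNIV"
proof -
  obtain \<B> :: "'a set set" where \<B>: "countable \<B>" "topological_basis \<B>"
    using ex_countable_basis by auto
  define \<C> where "\<C> = insert {} {V \<in> \<B>. \<exists>K. compact K \<and> V \<subseteq> K}"
  have C: "countable \<C>" "\<C> \<noteq> {}" "\<And>V. V \<in> \<C> \<Longrightarrow> \<exists>K. compact K \<and> V \<subseteq> K"
    using \<B>(1) by (auto simp: \<C>_def)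
  have cover: "\<exists>V\<in>\<C>. x \<in> V" for x
  proof -
    obtain U K where UK: "open U" "compact K" "x \<in> U" "U \<subseteq> K"
      using compact_neighbourhood[OF assms, of x] by metis
    obtain V where "V \<in> \<B>" "x \<in> V" "V \<subseteq> U"
      using topological_basisE[OF \<B>(2) UK(1,3)] by blast
    with UK show ?thesis by (auto simp: \<C>_def)
  qed
  define K where "K n = (SOME K. compact K \<and> from_nat_into \<C> n \<subseteq> K)" for n
  have K: "compact (K n) \<and> from_nat_into \<C> n \<subseteq> K n" for n
    unfolding K_def by (rule someI_ex) (intro C(3) from_nat_into C(2))
  have "x \<in> (\<Union>n. K n)" for x
    using cover[of x] from_nat_into_surj[OF C(1)] K by blast
  with K show ?thesis by (intro that[of K]) auto
qed

lemma sigma_finite_locally_finite: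
  fixes \<mu> :: "'a::{second_countable_topology, t2_space} measure"
  assumes "locally_compact_space (euclidean :: 'a topology)" "sets \<mu> = sets borel"
    "\<And>K. compact K \<Longrightarrow> emeasure \<mu> K < \<infinity>"
  shows "sigma_finite_measure \<mu>"
proof -
  obtain K :: "nat \<Rightarrow> 'a set" where K: "\<And>n. compact (K n)" "(\<Union>n. K n) = UNIV"
    using countable_compact_cover[OF assms(1)] by blast
  have "space \<mu> = UNIV" using sets_eq_imp_space_eq[OF assms(2)] by simp
  with K assms show ?thesis
    by (intro sigma_finite_measure.intro exI[of _ "range K"])
       (auto simp: compact_imp_closed borel_closed less_top[symmetric])
qed

text \<open>For kernels of subprobability measures this is a fact about the Giry monad.  A locally finite kernel
\<open>\<kappa>\<close> is a countable sum of rescaled subprobability kernels: cut the space into countably many pieces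
\<open>D n\<close> inside compact sets and divide the restriction of \<open>\<kappa> \<omega>\<close> to \<open>D n\<close> by \<open>1 + \<kappa> \<omega> (D n)\<close>, which is
finite, nonzero and a measurable function of \<open>\<omega>\<close>.\<close>

lemma borel_measurable_nn_integral_locally_finite_kernel:
  fixes \<kappa> :: "'w \<Rightarrow> 'a::{second_countable_topology, t2_space} measure"
  assumes lc: "locally_compact_space (euclidean :: 'a topology)"
    and sets: "\<And>\<omega>. \<omega> \<in> space M \<Longrightarrow> sets (\<kappa> \<omega>) = sets borel"
    and fin: "\<And>\<omega> K. \<omega> \<in> space M \<Longrightarrow> compact K \<Longrightarrow> emeasure (\<kappa> \<omega>) K < \<infinity>"
    and meas: "\<And>B. B \<in> sets borel \<Longrightarrow> (\<lambda>\<omega>. emeasure (\<kappa> \<omega>) B) \<in> borel_measurable M"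
    and F: "case_prod F \<in> borel_measurable (M \<Otimes>\<^sub>M borel)"
  shows "(\<lambda>\<omega>. \<integral>\<^sup>+x. F \<omega> x \<partial>\<kappa> \<omega>) \<in> borel_measurable M"
proof -
  obtain K :: "nat \<Rightarrow> 'a set" where K: "\<And>n. compact (K n)" "(\<Union>n. K n) = UNIV"
    using countable_compact_cover[OF lc] by blast
  have K_sets: "K n \<in> sets borel" for n
    using K(1) compact_imp_closed by (auto intro: borel_closed)
  define D where "D = disjointed K"
  have D: "D n \<in> sets borel" "D n \<subseteq> K n" for n
    using sets.range_disjointed_sets[of K borel] K_sets disjointed_subset[of K n] by (auto simp: D_def)
  have D_disj: "disjoint_family D" and D_UN: "(\<Union>n. D n) = UNIV"
    using disjoint_family_disjointed[of K] UN_disjointed_eq[of K] K(2) by (auto simp: D_def)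
  have D_fin: "emeasure (\<kappa> \<omega>) (D n) < \<infinity>" if "\<omega> \<in> space M" for \<omega> n
    using le_less_trans[OF emeasure_mono[OF D(2)[of n], of "\<kappa> \<omega>"] fin[OF that K(1)[of n]]]
      K_sets sets[OF that] by simp
  note [measurable] = D(1)
  define c where "c n \<omega> = 1 + emeasure (\<kappa> \<omega>) (D n)" for n \<omega>
  have c: "c n \<omega> \<noteq> 0" "\<omega> \<in> space M \<Longrightarrow> c n \<omega> \<noteq> top" for n \<omega>
    using D_fin[of \<omega> n] by (auto simp: c_def less_top)
  have [measurable]: "c n \<in> borel_measurable M" for n
    unfolding c_def[abs_def] using meas[OF D(1)] by measurable
  define L where "L n \<omega> = density (\<kappa> \<omega>) (\<lambda>x. indicator (D n) x / c n \<omega>)" for n \<omega>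
  have L_int: "(\<integral>\<^sup>+x. f x \<partial>L n \<omega>) = (\<integral>\<^sup>+x. f x * indicator (D n) x \<partial>\<kappa> \<omega>) / c n \<omega>"
    if "\<omega> \<in> space M" "f \<in> borel_measurable borel" for f n \<omega>
  proof -
    note [measurable_cong] = sets[OF that(1)] and [measurable] = that(2)
    have "(\<integral>\<^sup>+x. f x \<partial>L n \<omega>) = (\<integral>\<^sup>+x. f x * indicator (D n) x / c n \<omega> \<partial>\<kappa> \<omega>)"
      unfolding L_def by (subst nn_integral_density) (auto intro!: nn_integral_cong simp: ennreal_times_divide mult.commute)
    also have "\<dots> = (\<integral>\<^sup>+x. f x * indicator (D n) x \<partial>\<kappa> \<omega>) / c n \<omega>"
      by (rule nn_integral_divide) measurable
    finally show ?thesis .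
  qed
  have L_sets: "sets (L n \<omega>) = sets borel" if "\<omega> \<in> space M" for n \<omega>
    using sets[OF that] by (simp add: L_def)
  have L_em: "emeasure (L n \<omega>) B = emeasure (\<kappa> \<omega>) (B \<inter> D n) / c n \<omega>"
    if "\<omega> \<in> space M" "B \<in> sets borel" for B n \<omega>
    using L_int[OF that(1), of "indicator B" n] L_sets[OF that(1)] that sets[OF that(1)]
    by (simp add: indicator_inter_arith[symmetric])
  have L: "L n \<in> measurable M (subprob_algebra borel)" for n
  proof (rule measurable_subprob_algebra)
    fix \<omega> assume \<omega>: "\<omega> \<in> space M"
    have sp: "space (L n \<omega>) = UNIV" using sets_eq_imp_space_eq[OF L_sets[OF \<omega>]] by simp
    have "emeasure (L n \<omega>) UNIV = emeasure (\<kappa> \<omega>) (D n) / c n \<omega>"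
      using L_em[OF \<omega>, of UNIV] by simp
    also have "\<dots> \<le> c n \<omega> / c n \<omega>"
      by (intro divide_right_mono_ennreal) (simp add: c_def)
    also have "\<dots> = 1"
      using c(1)[of n \<omega>] c(2)[OF \<omega>, of n] by (intro ennreal_divide_self) (auto simp: less_top)
    finally show "subprob_space (L n \<omega>)"
      by (intro subprob_spaceI) (auto simp: sp)
    show "sets (L n \<omega>) = sets borel" by (rule L_sets[OF \<omega>])
  next
    fix B :: "'a set" assume B: "B \<in> sets borel"
    have "(\<lambda>\<omega>. emeasure (\<kappa> \<omega>) (B \<inter> D n) / c n \<omega>) \<in> borel_measurable M"
      using meas[of "B \<inter> D n"] B D(1) by measurable
    then show "(\<lambda>\<omega>. emeasure (L n \<omega>) B) \<in> borel_measurable M"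
      by (rule measurable_cong[THEN iffD1, rotated]) (simp add: L_em B)
  qed
  have "(\<lambda>\<omega>. \<Sum>n. c n \<omega> * (\<integral>\<^sup>+x. F \<omega> x \<partial>L n \<omega>)) \<in> borel_measurable M"
    using nn_integral_measurable_subprob_algebra2[OF F L] by measurable
  moreover have "(\<integral>\<^sup>+x. F \<omega> x \<partial>\<kappa> \<omega>) = (\<Sum>n. c n \<omega> * (\<integral>\<^sup>+x. F \<omega> x \<partial>L n \<omega>))"
    if \<omega>: "\<omega> \<in> space M" for \<omega>
  proof -
    note [measurable_cong] = sets[OF \<omega>]
    have [measurable]: "F \<omega> \<in> borel_measurable borel"
      using measurable_compose[OF measurable_Pair1'[OF \<omega>] F] by simp
    have "(\<integral>\<^sup>+x. F \<omega> x \<partial>\<kappa> \<omega>) = (\<integral>\<^sup>+x. (\<Sum>n. F \<omega> x * indicator (D n) x) \<partial>\<kappa> \<omega>)"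
      by (intro nn_integral_cong) (simp add: suminf_indicator[OF D_disj] D_UN)
    also have "\<dots> = (\<Sum>n. \<integral>\<^sup>+x. F \<omega> x * indicator (D n) x \<partial>\<kappa> \<omega>)"
      by (rule nn_integral_suminf) measurable
    also have "\<dots> = (\<Sum>n. c n \<omega> * (\<integral>\<^sup>+x. F \<omega> x \<partial>L n \<omega>))"
      using c \<omega> by (intro suminf_cong)
        (simp add: L_int ennreal_times_divide ennreal_mult_divide_eq mult.commute[of "c _ _"])
    finally show ?thesis .
  qed
  ultimately show ?thesis by (simp cong: measurable_cong)
qed

text \<open>The Palm measure and the mean measure are given by set functions of this shape.  A measure built
with \<open>measure_of\<close> from a set function that is not countably additive is zero, so null sets of the two
measures carry information only through this lemma.\<close>

lemma emeasure_mixture: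
  assumes sets: "\<And>\<omega>. \<omega> \<in> space Q \<Longrightarrow> sets (\<kappa> \<omega>) = sets N"
    and meas: "\<And>A. A \<in> sets N \<Longrightarrow> (\<lambda>\<omega>. emeasure (\<kappa> \<omega>) A) \<in> borel_measurable Q"
    and A: "A \<in> sets N"
  shows "emeasure (measure_of (space N) (sets N) (\<lambda>A. \<integral>\<^sup>+\<omega>. emeasure (\<kappa> \<omega>) A \<partial>Q)) A
    = (\<integral>\<^sup>+\<omega>. emeasure (\<kappa> \<omega>) A \<partial>Q)"
proof (rule emeasure_measure_of_sigma)
  show "countably_additive (sets N) (\<lambda>A. \<integral>\<^sup>+\<omega>. emeasure (\<kappa> \<omega>) A \<partial>Q)"
  proof (rule countably_additiveI)
    fix A :: "nat \<Rightarrow> _" assume A: "range A \<subseteq> sets N" "disjoint_family A" "(\<Union>i. A i) \<in> sets N"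
    have "(\<Sum>i. \<integral>\<^sup>+\<omega>. emeasure (\<kappa> \<omega>) (A i) \<partial>Q) = (\<integral>\<^sup>+\<omega>. (\<Sum>i. emeasure (\<kappa> \<omega>) (A i)) \<partial>Q)"
      using A by (intro nn_integral_suminf[symmetric] meas) auto
    also have "\<dots> = (\<integral>\<^sup>+\<omega>. emeasure (\<kappa> \<omega>) (\<Union>i. A i) \<partial>Q)"
      using A by (intro nn_integral_cong suminf_emeasure) (auto simp: sets)
    finally show "(\<Sum>i. \<integral>\<^sup>+\<omega>. emeasure (\<kappa> \<omega>) (A i) \<partial>Q) = (\<integral>\<^sup>+\<omega>. emeasure (\<kappa> \<omega>) (\<Union>i. A i) \<partial>Q)" .
  qed
qed (use A sets.sigma_algebra_axioms in \<open>auto simp: positive_def\<close>)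

text \<open>A point \<open>x\<close> that is not an atom has a neighbourhood of measure zero: neighbourhoods shrinking to \<open>x\<close>
have measures tending to zero, and these measures are integers.  By second countability the
non-atoms are therefore covered by countably many null sets.\<close>

lemma simple_counting_measure_diffuse_null:
  fixes \<mu> :: "'a::{second_countable_topology, t2_space} measure"
  assumes lc: "locally_compact_space (euclidean :: 'a topology)"
    and \<mu>: "simple_counting_measure \<mu>"
  shows "- points \<mu> \<in> null_sets \<mu>"
proof -
  have sets: "sets \<mu> = sets borel" and fin: "\<And>K. compact K \<Longrightarrow> emeasure \<mu> K < \<infinity>"
    and int: "\<And>B. B \<in> sets borel \<Longrightarrow> emeasure \<mu> B = \<infinity> \<or> (\<exists>n::nat. emeasure \<mu> B = of_nat n)"
    using \<mu> by (auto simp: simple_counting_measure_def)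
  obtain \<B> :: "'a set set" where \<B>: "countable \<B>" "topological_basis \<B>"
    using ex_countable_basis by auto
  \<comment> \<open>The intersection with \<open>U\<close> keeps the measures finite, as continuity from above requires.\<close>
  have "\<exists>V\<in>\<B>. x \<in> V \<and> emeasure \<mu> V = 0" if x: "emeasure \<mu> {x} = 0" for x
  proof -
    obtain U K where UK: "open U" "compact K" "x \<in> U" "U \<subseteq> K"
      using compact_neighbourhood[OF lc, of x] by metis
    obtain A :: "nat \<Rightarrow> 'a set" where A: "\<And>i. open (A i)" "\<And>i. x \<in> A i"
      and A_nhd: "\<And>S. open S \<Longrightarrow> x \<in> S \<Longrightarrow> eventually (\<lambda>i. A i \<subseteq> S) sequentially"
      using countable_basis_at_decseq[of x] by blast
    define W where "W n = U \<inter> (\<Inter>i\<le>n. A i)" for n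
    have W: "open (W n)" "x \<in> W n" for n
      using UK A by (auto simp: W_def intro!: open_Int open_INT)
    have "(\<Inter>n. W n) = {x}"
    proof -
      have "y = x" if y: "\<And>n. y \<in> W n" for y
      proof (rule ccontr)
        assume "y \<noteq> x"
        then obtain S where "open S" "x \<in> S" "y \<notin> S"
          using separation_t1[of x y] by blast
        with A_nhd[of S] have "\<exists>i. y \<notin> A i" by (auto simp: eventually_sequentially)
        then show False using y by (auto simp: W_def)
      qed
      then show ?thesis using W(2) by blast
    qed
    moreover have "(\<lambda>n. emeasure \<mu> (W n)) \<longlonglongrightarrow> emeasure \<mu> (\<Inter>n. W n)"
    proof (rule Lim_emeasure_decseq)
      show "range W \<subseteq> sets \<mu>" using W(1) by (auto simp: sets)
      show "decseq W" by (fastforce simp: decseq_def W_def)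
      have "W i \<subseteq> K" for i using UK(4) by (auto simp: W_def)
      then show "emeasure \<mu> (W i) \<noteq> \<infinity>" for i
        using le_less_trans[OF emeasure_mono[of "W i" K \<mu>] fin[OF UK(2)]] UK(2)
        by (simp add: sets compact_imp_closed borel_closed)
    qed
    ultimately have "(\<lambda>n. emeasure \<mu> (W n)) \<longlonglongrightarrow> 0" using x by simp
    from order_tendstoD(2)[OF this zero_less_one] obtain n where "emeasure \<mu> (W n) < 1"
      by (auto simp: eventually_sequentially)
    moreover have "emeasure \<mu> (W n) = \<infinity> \<or> (\<exists>k::nat. emeasure \<mu> (W n) = of_nat k)"
      using W(1)[of n] by (intro int) simp
    ultimately have W0: "emeasure \<mu> (W n) = 0"
      by (auto simp: of_nat_less_1_iff)
    obtain V where "V \<in> \<B>" "x \<in> V" "V \<subseteq> W n"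
      using topological_basisE[OF \<B>(2) W(1)[of n] W(2)[of n]] by blast
    moreover have "emeasure \<mu> V \<le> emeasure \<mu> (W n)"
      using \<open>V \<subseteq> W n\<close> W(1)[of n] by (intro emeasure_mono) (auto simp: sets)
    ultimately show ?thesis using W0 by auto
  qed
  moreover have "emeasure \<mu> {x} = 0" if "V \<in> \<B>" "x \<in> V" "emeasure \<mu> V = 0" for x V
  proof -
    have "V \<in> sets \<mu>" using topological_basis_open[OF \<B>(2) that(1)] by (simp add: sets)
    with emeasure_mono[of "{x}" V \<mu>] that show ?thesis by auto
  qed
  ultimately have eq: "- points \<mu> = (\<Union>V\<in>{V\<in>\<B>. emeasure \<mu> V = 0}. V)"
    by (auto simp: points_def)
  show ?thesis
    unfolding eq
    using \<B> topological_basis_open[OF \<B>(2)]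
    by (intro null_sets_UN') (auto simp: null_sets_def sets)
qed

section \<open>Measurability of coincidences\<close>

text \<open>In a Hausdorff space two distinct points lie in disjoint basic open sets, so the complement of the
diagonal is a union of rectangles \<open>U \<times> V\<close> with \<open>U\<close> and \<open>V\<close> disjoint members of a countable basis.\<close>

lemma measurable_diagonal_standard:
  assumes "standard_measurable_space S"
  shows "measurable_diagonal S"
proof -
  obtain T where T: "completely_metrizable_space T" "second_countable T" "topspace T = space S"
    and sets: "sets S = sigma_sets (topspace T) {U. openin T U}"
    using assms by (auto simp: standard_measurable_space_def)
  obtain \<B> where \<B>: "countable \<B>" "\<And>V. V \<in> \<B> \<Longrightarrow> openin T V"
    "\<And>U x. openin T U \<Longrightarrow> x \<in> U \<Longrightarrow> \<exists>V\<in>\<B>. x \<in> V \<and> V \<subseteq> U"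
    using T(2) unfolding second_countable_def by metis
  have haus: "Hausdorff_space T"
    using T(1) by (simp add: completely_metrizable_imp_metrizable_space metrizable_imp_Hausdorff_space)
  have open_sets: "U \<in> sets S" if "openin T U" for U
    using that by (auto simp: sets intro: sigma_sets.Basic)
  define R where "R = (\<Union>(U, V)\<in>{(U, V)\<in>\<B> \<times> \<B>. U \<inter> V = {}}. U \<times> V)"
  have "countable {(U, V)\<in>\<B> \<times> \<B>. U \<inter> V = {}}"
    using \<B>(1) by (intro countable_subset[OF _ countable_SIGMA[of \<B> "\<lambda>_. \<B>"]]) auto
  then have R: "R \<in> sets (S \<Otimes>\<^sub>M S)"
    unfolding R_def by (intro sets.countable_UN') (auto intro!: pair_measureI open_sets \<B>(2))
  have "(x, y) \<in> R" if "x \<in> space S" "y \<in> space S" "x \<noteq> y" for x y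
  proof -
    have "\<exists>U V. openin T U \<and> openin T V \<and> x \<in> U \<and> y \<in> V \<and> disjnt U V"
      using haus that T(3) unfolding Hausdorff_space_def by simp
    then obtain U V where "openin T U" "openin T V" "x \<in> U" "y \<in> V" "disjnt U V"
      by blast
    then obtain U' V' where "U' \<in> \<B>" "x \<in> U'" "U' \<subseteq> U" "V' \<in> \<B>" "y \<in> V'" "V' \<subseteq> V"
      using \<B>(3) by metis
    moreover from this \<open>disjnt U V\<close> have "U' \<inter> V' = {}"
      by (auto simp: disjnt_def)
    ultimately show ?thesis unfolding R_def by blast
  qed
  moreover have "(x, x) \<notin> R" for x by (auto simp: R_def)
  ultimately have "{(s, s) |s. s \<in> space S} = space (S \<Otimes>\<^sub>M S) - R"
    by (auto simp: space_pair_measure)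
  then show ?thesis using R by (simp add: measurable_diagonal_def)
qed

lemma measurable_coincidences_of_diagonal:
  fixes f :: "'a::{topological_group_add, second_countable_topology} \<Rightarrow> 's"
  assumes f [measurable]: "f \<in> borel \<rightarrow>\<^sub>M S" and "measurable_diagonal S"
  shows "measurable_coincidences f"
proof -
  have "(\<lambda>(x, y). (f x, f (x + y))) \<in> (borel \<Otimes>\<^sub>M borel) \<rightarrow>\<^sub>M S \<Otimes>\<^sub>M S" by measurable
  from measurable_sets[OF this] assms(2)
  have "(\<lambda>(x, y). (f x, f (x + y))) -` {(s, s) |s. s \<in> space S} \<inter> space (borel \<Otimes>\<^sub>M borel)
    \<in> sets (borel \<Otimes>\<^sub>M borel)"
    unfolding measurable_diagonal_def by blast
  also have "(\<lambda>(x, y). (f x, f (x + y))) -` {(s, s) |s. s \<in> space S} \<inter> space (borel \<Otimes>\<^sub>M borel)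
    = {(x, y). f x = f (x + y)}"
    using measurable_space[OF f] by (auto simp: space_pair_measure)
  finally show ?thesis by (simp add: measurable_coincidences_def)
qed

section \<open>Null sets of Haar measure\<close>

locale Haar_group =
  fixes haar :: "'a::{topological_group_add, second_countable_topology, t2_space} measure"
  assumes locally_compact: "locally_compact_space (euclidean :: 'a topology)"
    and Haar: "left_Haar_measure haar"
begin

lemma sets_haar [measurable_cong]: "sets haar = sets borel"
  using Haar by (simp add: left_Haar_measure_def)

lemma sigma_finite_haar: "sigma_finite_measure haar"
  using Haar by (intro sigma_finite_locally_finite locally_compact) (auto simp: left_Haar_measure_def)

lemma nn_integral_haar_translate:
  assumes [measurable]: "h \<in> borel_measurable borel"
  shows "(\<integral>\<^sup>+x. h (a + x) \<partial>haar) = (\<integral>\<^sup>+x. h x \<partial>haar)"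
proof -
  have "distr haar borel ((+) a) = haar"
  proof (rule measure_eqI)
    fix B assume "B \<in> sets (distr haar borel ((+) a))"
    then have [measurable]: "B \<in> sets borel" by simp
    have "emeasure (distr haar borel ((+) a)) B = emeasure haar ((\<lambda>y. - a + y) ` B)"
      using sets_eq_imp_space_eq[OF sets_haar]
      by (subst emeasure_distr) (simp_all add: image_plus_eq_vimage)
    also have "\<dots> = emeasure haar B"
      using Haar by (simp add: left_Haar_measure_def)
    finally show "emeasure (distr haar borel ((+) a)) B = emeasure haar B" .
  qed (simp add: sets_haar)
  then have "(\<integral>\<^sup>+x. h x \<partial>haar) = (\<integral>\<^sup>+x. h x \<partial>distr haar borel ((+) a))" by simp
  also have "\<dots> = (\<integral>\<^sup>+x. h (a + x) \<partial>haar)"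
    by (rule nn_integral_distr) measurable
  finally show ?thesis ..
qed

text \<open>Haar measure need not be invariant under reflection or right translation, but its null sets are.
If \<open>h\<close> has integral zero, then so has \<open>y \<mapsto> h (- x + y)\<close> for every \<open>x\<close> by left invariance.
Integrating over \<open>x\<close> first and translating \<open>x\<close> by \<open>y\<close> turns the double integral into the integral of
\<open>h (- x)\<close> times the total mass of \<open>haar\<close>, which is not zero.\<close>

lemma nn_integral_haar_reflect_eq_0:
  fixes h :: "'a \<Rightarrow> ennreal"
  assumes [measurable]: "h \<in> borel_measurable borel" and h0: "(\<integral>\<^sup>+x. h x \<partial>haar) = 0"
  shows "(\<integral>\<^sup>+x. h (- x) \<partial>haar) = 0"
proof -
  interpret pair_sigma_finite haar haar
    by (intro pair_sigma_finite.intro sigma_finite_haar)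
  have "(\<integral>\<^sup>+x. h (- x) \<partial>haar) * emeasure haar (space haar) = (\<integral>\<^sup>+y. \<integral>\<^sup>+x. h (- x) \<partial>haar \<partial>haar)"
    by simp
  also have "\<dots> = (\<integral>\<^sup>+y. \<integral>\<^sup>+x. h (- x + y) \<partial>haar \<partial>haar)"
  proof (rule nn_integral_cong)
    fix y
    show "(\<integral>\<^sup>+x. h (- x) \<partial>haar) = (\<integral>\<^sup>+x. h (- x + y) \<partial>haar)"
      using nn_integral_haar_translate[of "\<lambda>x. h (- x + y)" y]
      by (simp add: minus_add add.assoc)
  qed
  also have "\<dots> = (\<integral>\<^sup>+x. \<integral>\<^sup>+y. h (- x + y) \<partial>haar \<partial>haar)"
    by (rule Fubini') measurable
  also have "\<dots> = 0"
    by (simp add: nn_integral_haar_translate h0)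
  finally show ?thesis
    using Haar sets_eq_imp_space_eq[OF sets_haar] by (simp add: left_Haar_measure_def)
qed

text \<open>A right translation is a left translation conjugated by the reflection.\<close>

lemma nn_integral_haar_right_translate_eq_0:
  fixes h :: "'a \<Rightarrow> ennreal"
  assumes [measurable]: "h \<in> borel_measurable borel" and "(\<integral>\<^sup>+x. h x \<partial>haar) = 0"
  shows "(\<integral>\<^sup>+x. h (x + a) \<partial>haar) = 0"
proof -
  have "(\<integral>\<^sup>+x. h (- (- a + x)) \<partial>haar) = 0"
    using nn_integral_haar_translate[of "\<lambda>x. h (- x)" "- a"] nn_integral_haar_reflect_eq_0[OF assms]
    by simp
  from nn_integral_haar_reflect_eq_0[OF _ this] show ?thesis
    by (simp add: minus_add)
qed

end

section \<open>Flow-adapted point processes\<close>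

locale stationary_point_process = Haar_group haar
  for haar :: "'a::{topological_group_add, second_countable_topology, t2_space} measure" +
  fixes P :: "'w measure" and \<theta> :: "'a \<Rightarrow> 'w \<Rightarrow> 'w" and \<mm> :: "'w \<Rightarrow> 'a measure"
  assumes framework: "stationary_framework P \<theta>"
    and simple: "simple_point_process P \<mm>"
    and adapted: "flow_adapted P \<theta> \<mm>"
begin

lemma prob_space_P: "prob_space P"
  using framework by (simp add: stationary_framework_def)

lemma shift_measurable_pair: "(\<lambda>(x, \<omega>). \<theta> x \<omega>) \<in> borel \<Otimes>\<^sub>M P \<rightarrow>\<^sub>M P"
  using framework by (simp add: stationary_framework_def)

lemma shift_measurable [measurable (raw)]:
  assumes "u \<in> M \<rightarrow>\<^sub>M borel" "v \<in> M \<rightarrow>\<^sub>M P"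
  shows "(\<lambda>x. \<theta> (u x) (v x)) \<in> M \<rightarrow>\<^sub>M P"
  using measurable_compose[OF measurable_Pair[OF assms] shift_measurable_pair] by simp

lemma shift_in_space: "\<omega> \<in> space P \<Longrightarrow> \<theta> x \<omega> \<in> space P"
  using measurable_space[OF shift_measurable_pair, of "(x, \<omega>)"] by (simp add: space_pair_measure)

lemma shift_add: "\<omega> \<in> space P \<Longrightarrow> \<theta> x (\<theta> y \<omega>) = \<theta> (x + y) \<omega>"
  using framework by (simp add: stationary_framework_def)

lemma counting: "\<omega> \<in> space P \<Longrightarrow> simple_counting_measure (\<mm> \<omega>)"
  using simple by (simp add: simple_point_process_def)

lemma sets_process: "\<omega> \<in> space P \<Longrightarrow> sets (\<mm> \<omega>) = sets borel"
  using counting by (simp add: simple_counting_measure_def)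

lemma process_compact_finite: "\<omega> \<in> space P \<Longrightarrow> compact K \<Longrightarrow> emeasure (\<mm> \<omega>) K < \<infinity>"
  using counting by (simp add: simple_counting_measure_def)

lemma space_process: "\<omega> \<in> space P \<Longrightarrow> space (\<mm> \<omega>) = UNIV"
  using sets_eq_imp_space_eq[OF sets_process] by simp

lemma sigma_finite_process: "\<omega> \<in> space P \<Longrightarrow> sigma_finite_measure (\<mm> \<omega>)"
  by (intro sigma_finite_locally_finite locally_compact sets_process process_compact_finite)

lemma emeasure_process_measurable [measurable (raw)]:
  "v \<in> M \<rightarrow>\<^sub>M P \<Longrightarrow> B \<in> sets borel \<Longrightarrow> (\<lambda>x. emeasure (\<mm> (v x)) B) \<in> borel_measurable M"
  using simple by (auto simp: simple_point_process_def intro: measurable_compose[of v M P])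

lemma nn_integral_process_measurable [measurable (raw)]:
  assumes v: "v \<in> M \<rightarrow>\<^sub>M P" and "case_prod F \<in> borel_measurable (M \<Otimes>\<^sub>M borel)"
  shows "(\<lambda>x. \<integral>\<^sup>+y. F x y \<partial>\<mm> (v x)) \<in> borel_measurable M"
proof -
  have sp: "v x \<in> space P" if "x \<in> space M" for x
    using measurable_space[OF v that] .
  show ?thesis
    using assms
    by (intro borel_measurable_nn_integral_locally_finite_kernel locally_compact)
       (auto simp: sp sets_process process_compact_finite[unfolded infinity_ennreal_def]
             intro: emeasure_process_measurable)
qed

lemma process_shift: 
  assumes \<omega>: "\<omega> \<in> space P"
  shows "\<mm> (\<theta> t \<omega>) = distr (\<mm> \<omega>) borel ((+) t)"
proof (rule measure_eqI)
  note [measurable_cong] = sets_process[OF \<omega>]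
  fix B assume "B \<in> sets (\<mm> (\<theta> t \<omega>))"
  then have [measurable]: "B \<in> sets borel" by (simp add: sets_process shift_in_space \<omega>)
  have "emeasure (\<mm> (\<theta> t \<omega>)) B = emeasure (\<mm> \<omega>) ((\<lambda>y. - t + y) ` B)"
    using adapted \<omega> by (simp add: flow_adapted_def)
  also have "\<dots> = emeasure (distr (\<mm> \<omega>) borel ((+) t)) B"
    by (subst emeasure_distr) (simp_all add: image_plus_eq_vimage space_process \<omega>)
  finally show "emeasure (\<mm> (\<theta> t \<omega>)) B = emeasure (distr (\<mm> \<omega>) borel ((+) t)) B" .
qed (simp add: sets_process shift_in_space \<omega>)

lemma nn_integral_process_shift:
  assumes \<omega>: "\<omega> \<in> space P" and [measurable]: "h \<in> borel_measurable borel"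
  shows "(\<integral>\<^sup>+x. h x \<partial>\<mm> (\<theta> t \<omega>)) = (\<integral>\<^sup>+x. h (t + x) \<partial>\<mm> \<omega>)"
proof -
  note [measurable_cong] = sets_process[OF \<omega>]
  show ?thesis unfolding process_shift[OF \<omega>] by (rule nn_integral_distr) measurable
qed

lemma emeasure_process_shift_singleton:
  "\<omega> \<in> space P \<Longrightarrow> emeasure (\<mm> (\<theta> t \<omega>)) {x} = emeasure (\<mm> \<omega>) {- t + x}"
  using adapted by (simp add: flow_adapted_def)

text \<open>Stationarity in the form of an invariance of the Campbell measure \<open>P(d\<omega>) \<mm>(\<omega>, dx)\<close> under the joint
shift \<open>(\<omega>, x) \<mapsto> (\<theta> t \<omega>, t + x)\<close>.\<close>

lemma stationarity:
  assumes [measurable]: "case_prod G \<in> borel_measurable (P \<Otimes>\<^sub>M borel)"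
  shows "(\<integral>\<^sup>+\<omega>. \<integral>\<^sup>+x. G \<omega> x \<partial>\<mm> \<omega> \<partial>P) = (\<integral>\<^sup>+\<omega>. \<integral>\<^sup>+x. G (\<theta> t \<omega>) (t + x) \<partial>\<mm> \<omega> \<partial>P)"
proof -
  have "(\<integral>\<^sup>+\<omega>. \<integral>\<^sup>+x. G \<omega> x \<partial>\<mm> \<omega> \<partial>P) = (\<integral>\<^sup>+\<omega>. \<integral>\<^sup>+x. G \<omega> x \<partial>\<mm> \<omega> \<partial>distr P P (\<theta> t))"
    using framework by (simp add: stationary_framework_def)
  also have "\<dots> = (\<integral>\<^sup>+\<omega>. \<integral>\<^sup>+x. G (\<theta> t \<omega>) x \<partial>\<mm> (\<theta> t \<omega>) \<partial>P)"
    by (rule nn_integral_distr) measurable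
  also have "\<dots> = (\<integral>\<^sup>+\<omega>. \<integral>\<^sup>+x. G (\<theta> t \<omega>) (t + x) \<partial>\<mm> \<omega> \<partial>P)"
  proof (rule nn_integral_cong)
    fix \<omega> assume \<omega>: "\<omega> \<in> space P"
    have "G (\<theta> t \<omega>) \<in> borel_measurable borel"
      using measurable_compose[OF measurable_Pair1'[OF shift_in_space[OF \<omega>]] assms] by simp
    then show "(\<integral>\<^sup>+x. G (\<theta> t \<omega>) x \<partial>\<mm> (\<theta> t \<omega>)) = (\<integral>\<^sup>+x. G (\<theta> t \<omega>) (t + x) \<partial>\<mm> \<omega>)"
      by (rule nn_integral_process_shift[OF \<omega>])
  qed
  finally show ?thesis .
qed

text \<open>Two applications of Fubini, one for \<open>haar\<close> and \<open>P\<close> and one for \<open>haar\<close> and each \<open>\<mm> \<omega>\<close>.  In this way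
sigma-finiteness of the Campbell measure is never an issue.\<close>

lemma nn_integral_haar_process_swap:
  assumes [measurable]: "F \<in> borel_measurable ((borel \<Otimes>\<^sub>M P) \<Otimes>\<^sub>M borel)"
  shows "(\<integral>\<^sup>+t. \<integral>\<^sup>+\<omega>. \<integral>\<^sup>+x. F ((t, \<omega>), x) \<partial>\<mm> \<omega> \<partial>P \<partial>haar) = (\<integral>\<^sup>+\<omega>. \<integral>\<^sup>+x. \<integral>\<^sup>+t. F ((t, \<omega>), x) \<partial>haar \<partial>\<mm> \<omega> \<partial>P)"
proof -
  interpret P: prob_space P by (rule prob_space_P)
  interpret haarP: pair_sigma_finite haar P
    by (intro pair_sigma_finite.intro sigma_finite_haar P.sigma_finite_measure_axioms)
  have "(\<integral>\<^sup>+t. \<integral>\<^sup>+\<omega>. \<integral>\<^sup>+x. F ((t, \<omega>), x) \<partial>\<mm> \<omega> \<partial>P \<partial>haar) = (\<integral>\<^sup>+\<omega>. \<integral>\<^sup>+t. \<integral>\<^sup>+x. F ((t, \<omega>), x) \<partial>\<mm> \<omega> \<partial>haar \<partial>P)"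
    by (rule haarP.Fubini'[symmetric]) measurable
  also have "\<dots> = (\<integral>\<^sup>+\<omega>. \<integral>\<^sup>+x. \<integral>\<^sup>+t. F ((t, \<omega>), x) \<partial>haar \<partial>\<mm> \<omega> \<partial>P)"
  proof (rule nn_integral_cong)
    fix \<omega> assume \<omega>: "\<omega> \<in> space P"
    interpret pair_sigma_finite haar "\<mm> \<omega>"
      by (intro pair_sigma_finite.intro sigma_finite_haar sigma_finite_process \<omega>)
    note [measurable_cong] = sets_process[OF \<omega>]
    have "(\<lambda>(t, x). F ((t, \<omega>), x)) \<in> borel_measurable (haar \<Otimes>\<^sub>M \<mm> \<omega>)"
      using \<omega> by measurable
    then show "(\<integral>\<^sup>+t. \<integral>\<^sup>+x. F ((t, \<omega>), x) \<partial>\<mm> \<omega> \<partial>haar) = (\<integral>\<^sup>+x. \<integral>\<^sup>+t. F ((t, \<omega>), x) \<partial>haar \<partial>\<mm> \<omega>)"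
      by (rule Fubini'[symmetric])
  qed
  finally show ?thesis .
qed

text \<open>This replaces the refined Campbell formula.  For fixed \<open>t\<close> the joint shift of \<open>(\<omega>, x)\<close> by \<open>t\<close> leaves
\<open>\<theta> (- x) \<omega>\<close> unchanged, so it moves the translation by \<open>t\<close> from the argument of \<open>g\<close> to the argument of
\<open>w\<close>.  After integration over \<open>t\<close> the weight contributes only the constant \<open>\<integral> w (- t) dt\<close>, because
\<open>\<integral> w (- t + x) dt\<close> does not depend on \<open>x\<close> by left invariance.  On the left-hand side \<open>g\<close> is
integrated over a right translate.  This would introduce the modular function if the value of the
integral mattered, but here only its vanishing does.\<close>

lemma weight_exchange:
  fixes w :: "'a \<Rightarrow> ennreal"
  assumes g [measurable]: "case_prod g \<in> borel_measurable (borel \<Otimes>\<^sub>M P)"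
    and w [measurable]: "w \<in> borel_measurable borel"
  shows "(\<integral>\<^sup>+\<omega>. \<integral>\<^sup>+x. w x * (\<integral>\<^sup>+t. g (t + x) (\<theta> (- x) \<omega>) \<partial>haar) \<partial>\<mm> \<omega> \<partial>P)
    = (\<integral>\<^sup>+t. w (- t) \<partial>haar) * (\<integral>\<^sup>+\<omega>. \<integral>\<^sup>+x. g x (\<theta> (- x) \<omega>) \<partial>\<mm> \<omega> \<partial>P)"
proof -
  interpret sigma_finite_measure haar by (rule sigma_finite_haar)
  have shift: "(\<integral>\<^sup>+\<omega>. \<integral>\<^sup>+x. w x * g (t + x) (\<theta> (- x) \<omega>) \<partial>\<mm> \<omega> \<partial>P)
    = (\<integral>\<^sup>+\<omega>. \<integral>\<^sup>+x. w (- t + x) * g x (\<theta> (- x) \<omega>) \<partial>\<mm> \<omega> \<partial>P)" for t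
  proof -
    have "(\<integral>\<^sup>+\<omega>. \<integral>\<^sup>+x. w (- t + x) * g x (\<theta> (- x) \<omega>) \<partial>\<mm> \<omega> \<partial>P)
      = (\<integral>\<^sup>+\<omega>. \<integral>\<^sup>+x. w (- t + (t + x)) * g (t + x) (\<theta> (- (t + x)) (\<theta> t \<omega>)) \<partial>\<mm> \<omega> \<partial>P)"
      by (rule stationarity) measurable
    also have "\<dots> = (\<integral>\<^sup>+\<omega>. \<integral>\<^sup>+x. w x * g (t + x) (\<theta> (- x) \<omega>) \<partial>\<mm> \<omega> \<partial>P)"
      by (intro nn_integral_cong) (simp add: shift_add minus_add)
    finally show ?thesis ..
  qed
  have "(\<integral>\<^sup>+\<omega>. \<integral>\<^sup>+x. w x * (\<integral>\<^sup>+t. g (t + x) (\<theta> (- x) \<omega>) \<partial>haar) \<partial>\<mm> \<omega> \<partial>P)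
    = (\<integral>\<^sup>+\<omega>. \<integral>\<^sup>+x. \<integral>\<^sup>+t. w x * g (t + x) (\<theta> (- x) \<omega>) \<partial>haar \<partial>\<mm> \<omega> \<partial>P)"
    by (intro nn_integral_cong nn_integral_cmult[symmetric]) measurable
  also have "\<dots> = (\<integral>\<^sup>+t. \<integral>\<^sup>+\<omega>. \<integral>\<^sup>+x. w x * g (t + x) (\<theta> (- x) \<omega>) \<partial>\<mm> \<omega> \<partial>P \<partial>haar)"
    using nn_integral_haar_process_swap
      [of "\<lambda>p. w (snd p) * g (fst (fst p) + snd p) (\<theta> (- snd p) (snd (fst p)))"] by simp
  also have "\<dots> = (\<integral>\<^sup>+t. \<integral>\<^sup>+\<omega>. \<integral>\<^sup>+x. w (- t + x) * g x (\<theta> (- x) \<omega>) \<partial>\<mm> \<omega> \<partial>P \<partial>haar)"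
    by (simp only: shift)
  also have "\<dots> = (\<integral>\<^sup>+\<omega>. \<integral>\<^sup>+x. \<integral>\<^sup>+t. w (- t + x) * g x (\<theta> (- x) \<omega>) \<partial>haar \<partial>\<mm> \<omega> \<partial>P)"
    using nn_integral_haar_process_swap
      [of "\<lambda>p. w (- fst (fst p) + snd p) * g (snd p) (\<theta> (- snd p) (snd (fst p)))"] by simp
  also have "\<dots> = (\<integral>\<^sup>+\<omega>. \<integral>\<^sup>+x. (\<integral>\<^sup>+t. w (- t) \<partial>haar) * g x (\<theta> (- x) \<omega>) \<partial>\<mm> \<omega> \<partial>P)"
  proof (intro nn_integral_cong)
    fix \<omega> x
    have "(\<integral>\<^sup>+t. w (- t + x) \<partial>haar) = (\<integral>\<^sup>+t. w (- t) \<partial>haar)"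
      using nn_integral_haar_translate[of "\<lambda>t. w (- t + x)" x] by (simp add: minus_add add.assoc)
    then show "(\<integral>\<^sup>+t. w (- t + x) * g x (\<theta> (- x) \<omega>) \<partial>haar) = (\<integral>\<^sup>+t. w (- t) \<partial>haar) * g x (\<theta> (- x) \<omega>)"
      by (subst nn_integral_multc) simp_all
  qed
  also have "\<dots> = (\<integral>\<^sup>+\<omega>. (\<integral>\<^sup>+t. w (- t) \<partial>haar) * (\<integral>\<^sup>+x. g x (\<theta> (- x) \<omega>) \<partial>\<mm> \<omega>) \<partial>P)"
  proof (intro nn_integral_cong nn_integral_cmult)
    fix \<omega> assume \<omega>: "\<omega> \<in> space P"
    note [measurable_cong] = sets_process[OF \<omega>]
    show "(\<lambda>x. g x (\<theta> (- x) \<omega>)) \<in> borel_measurable (\<mm> \<omega>)" using \<omega> by measurable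
  qed
  also have "\<dots> = (\<integral>\<^sup>+t. w (- t) \<partial>haar) * (\<integral>\<^sup>+\<omega>. \<integral>\<^sup>+x. g x (\<theta> (- x) \<omega>) \<partial>\<mm> \<omega> \<partial>P)"
    by (rule nn_integral_cmult) measurable
  finally show ?thesis .
qed

section \<open>Pairs of points in a prescribed relation\<close>

text \<open>Let \<open>g x \<omega>\<close> be the number of points \<open>y\<close> of \<open>\<mm> \<omega>\<close> with \<open>(x, y) \<in> E\<close>.  Seen from a point \<open>X\<close> of \<open>\<mm> \<omega>\<close>,
the points \<open>Y\<close> are at the displacements \<open>- X + Y\<close>, and these are the points of \<open>\<mm> (\<theta> (- X) \<omega>)\<close>.
Thus \<open>g X (\<theta> (- X) \<omega>)\<close> counts the \<open>Y\<close> with \<open>(X, - X + Y) \<in> E\<close>, and it has to vanish almost surely for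
all points \<open>X\<close>.  The set \<open>Z\<close> consists of the displacements \<open>y\<close> for which \<open>{x. (x, y) \<in> E}\<close> is not a
null set.  If \<open>\<mm> \<omega>\<close> has no point in \<open>Z\<close>, then Fubini shows that \<open>g t \<omega> = 0\<close> for almost every \<open>t\<close>.
By the assumption \<open>null\<close> this applies to \<open>\<theta> (- x) \<omega>\<close> for almost all \<open>x\<close> and \<open>\<omega>\<close> with \<open>w x > 0\<close>, and the
exchange of weights removes the restriction to such \<open>x\<close>.\<close>

lemma AE_no_related_points:
  fixes w :: "'a \<Rightarrow> ennreal"
  assumes E [measurable]: "E \<in> sets (borel \<Otimes>\<^sub>M borel)"
    and w [measurable]: "w \<in> borel_measurable borel" and w_pos: "(\<integral>\<^sup>+x. w x \<partial>haar) \<noteq> 0"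
    and Z: "Z = {y. (\<integral>\<^sup>+x. indicator E (x, y) \<partial>haar) \<noteq> 0}"
    and A: "A = {\<omega> \<in> space P. emeasure (\<mm> \<omega>) Z \<noteq> 0}"
    and null: "(\<integral>\<^sup>+\<omega>. \<integral>\<^sup>+x. indicator A (\<theta> (- x) \<omega>) * w x \<partial>\<mm> \<omega> \<partial>P) = 0"
  shows "AE \<omega> in P. \<forall>X\<in>points (\<mm> \<omega>). \<forall>Y\<in>points (\<mm> \<omega>). (X, - X + Y) \<notin> E"
proof -
  interpret haar: sigma_finite_measure haar by (rule sigma_finite_haar)
  have Z_sets [measurable]: "Z \<in> sets borel"
  proof -
    have "{y \<in> space borel. (\<integral>\<^sup>+x. indicator E (x, y) \<partial>haar) \<noteq> 0} \<in> sets borel" by measurable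
    then show ?thesis by (simp add: Z)
  qed
  have A_sets [measurable]: "A \<in> sets P" unfolding A by measurable
  define g :: "'a \<Rightarrow> 'w \<Rightarrow> ennreal" where "g x \<omega> = (\<integral>\<^sup>+y. indicator E (x, y) \<partial>\<mm> \<omega>)" for x \<omega>
  have g [measurable]: "case_prod g \<in> borel_measurable (borel \<Otimes>\<^sub>M P)"
    unfolding g_def[abs_def] by measurable
  have g0: "(\<integral>\<^sup>+t. g t \<omega> \<partial>haar) = 0" if \<omega>: "\<omega> \<in> space P" "\<omega> \<notin> A" for \<omega>
  proof -
    interpret pair_sigma_finite haar "\<mm> \<omega>"
      by (intro pair_sigma_finite.intro sigma_finite_haar sigma_finite_process \<omega>)
    note [measurable_cong] = sets_process[OF \<omega>(1)]
    have "(\<integral>\<^sup>+t. g t \<omega> \<partial>haar) = (\<integral>\<^sup>+y. \<integral>\<^sup>+t. indicator E (t, y) \<partial>haar \<partial>\<mm> \<omega>)"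
      unfolding g_def by (rule Fubini'[symmetric]) measurable
    also have "\<dots> = (\<integral>\<^sup>+y. 0 \<partial>\<mm> \<omega>)"
    proof (rule nn_integral_cong_AE)
      have "AE y in \<mm> \<omega>. y \<notin> Z"
        using \<omega> by (intro AE_not_in) (auto simp: A null_sets_def sets_process)
      then show "AE y in \<mm> \<omega>. (\<integral>\<^sup>+t. indicator E (t, y) \<partial>haar) = 0"
        by eventually_elim (simp add: Z)
    qed
    finally show ?thesis by simp
  qed
  \<comment> \<open>On \<open>A\<close> nothing is known about the inner integral, hence the factor \<open>\<infinity>\<close>.\<close>
  have "(\<integral>\<^sup>+\<omega>. \<integral>\<^sup>+x. w x * (\<integral>\<^sup>+t. g (t + x) (\<theta> (- x) \<omega>) \<partial>haar) \<partial>\<mm> \<omega> \<partial>P)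
    \<le> (\<integral>\<^sup>+\<omega>. \<integral>\<^sup>+x. \<infinity> * (indicator A (\<theta> (- x) \<omega>) * w x) \<partial>\<mm> \<omega> \<partial>P)"
  proof (intro nn_integral_mono)
    fix \<omega> x assume \<omega>: "\<omega> \<in> space P"
    have "(\<integral>\<^sup>+t. g (t + x) (\<theta> (- x) \<omega>) \<partial>haar) = 0" if "\<theta> (- x) \<omega> \<notin> A"
      using shift_in_space[OF \<omega>] that
      by (intro nn_integral_haar_right_translate_eq_0[where h="\<lambda>t. g t (\<theta> (- x) \<omega>)"] g0) measurable
    then show "w x * (\<integral>\<^sup>+t. g (t + x) (\<theta> (- x) \<omega>) \<partial>haar) \<le> \<infinity> * (indicator A (\<theta> (- x) \<omega>) * w x)"
      by (cases "w x = 0") (auto simp: indicator_def ennreal_top_mult)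
  qed
  also have "\<dots> = (\<integral>\<^sup>+\<omega>. \<infinity> * (\<integral>\<^sup>+x. indicator A (\<theta> (- x) \<omega>) * w x \<partial>\<mm> \<omega>) \<partial>P)"
  proof (intro nn_integral_cong nn_integral_cmult)
    fix \<omega> assume \<omega>: "\<omega> \<in> space P"
    note [measurable_cong] = sets_process[OF \<omega>]
    show "(\<lambda>x. indicator A (\<theta> (- x) \<omega>) * w x) \<in> borel_measurable (\<mm> \<omega>)" using \<omega> by measurable
  qed
  also have "\<dots> = \<infinity> * (\<integral>\<^sup>+\<omega>. \<integral>\<^sup>+x. indicator A (\<theta> (- x) \<omega>) * w x \<partial>\<mm> \<omega> \<partial>P)"
    by (rule nn_integral_cmult) measurable
  finally have "(\<integral>\<^sup>+t. w (- t) \<partial>haar) * (\<integral>\<^sup>+\<omega>. \<integral>\<^sup>+x. g x (\<theta> (- x) \<omega>) \<partial>\<mm> \<omega> \<partial>P) = 0"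
    using null weight_exchange[OF g w] by simp
  moreover have "(\<integral>\<^sup>+t. w (- t) \<partial>haar) \<noteq> 0"
    using nn_integral_haar_reflect_eq_0[of "\<lambda>t. w (- t)"] w_pos by auto
  ultimately have "(\<integral>\<^sup>+\<omega>. \<integral>\<^sup>+x. g x (\<theta> (- x) \<omega>) \<partial>\<mm> \<omega> \<partial>P) = 0" by simp
  then have "AE \<omega> in P. (\<integral>\<^sup>+x. g x (\<theta> (- x) \<omega>) \<partial>\<mm> \<omega>) = 0"
    by (subst (asm) nn_integral_0_iff_AE) measurable
  then show ?thesis
  proof (rule AE_mp, intro AE_I2 impI ballI)
    fix \<omega> X Y assume \<omega>: "\<omega> \<in> space P" and 0: "(\<integral>\<^sup>+x. g x (\<theta> (- x) \<omega>) \<partial>\<mm> \<omega>) = 0"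
      and X: "X \<in> points (\<mm> \<omega>)" and Y: "Y \<in> points (\<mm> \<omega>)"
    \<comment> \<open>A function that is zero almost everywhere vanishes at every atom.\<close>
    have atom: "h a = 0" if "\<omega>' \<in> space P" "h \<in> borel_measurable borel" "(\<integral>\<^sup>+x. h x \<partial>\<mm> \<omega>') = 0"
      "emeasure (\<mm> \<omega>') {a} \<noteq> 0" for h :: "'a \<Rightarrow> ennreal" and a \<omega>'
    proof -
      note [measurable_cong] = sets_process[OF that(1)] and [measurable] = that(2)
      have "h a * emeasure (\<mm> \<omega>') {a} = (\<integral>\<^sup>+x. h a * indicator {a} x \<partial>\<mm> \<omega>')"
        by (subst nn_integral_cmult_indicator) (simp_all add: sets_process that(1))
      also have "\<dots> \<le> (\<integral>\<^sup>+x. h x \<partial>\<mm> \<omega>')"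
        by (intro nn_integral_mono) (simp add: indicator_def)
      finally show ?thesis using that by simp
    qed
    have "g X (\<theta> (- X) \<omega>) = 0"
      using X \<omega> 0 by (intro atom[of \<omega> "\<lambda>x. g x (\<theta> (- x) \<omega>)"]) (auto simp: points_def)
    then have "indicator E (X, - X + Y) = (0::ennreal)"
      using Y shift_in_space[OF \<omega>, of "- X"] unfolding g_def
      by (intro atom[of "\<theta> (- X) \<omega>" "\<lambda>y. indicator E (X, y)"])
         (auto simp: points_def emeasure_process_shift_singleton[OF \<omega>] add.assoc[symmetric])
    then show "(X, - X + Y) \<notin> E" by (simp add: indicator_def split: if_splits)
  qed
qed

section \<open>Palm measure and reduced mean measure\<close>

lemma emeasure_palm_measure:
  assumes [measurable]: "w \<in> borel_measurable borel" and A [measurable]: "A \<in> sets P"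
  shows "emeasure (palm_measure P \<theta> \<mm> \<gamma> w) A
    = (\<integral>\<^sup>+\<omega>. \<integral>\<^sup>+x. indicator A (\<theta> (- x) \<omega>) * ennreal (w x) \<partial>\<mm> \<omega> \<partial>P) / \<gamma>"
proof -
  \<comment> \<open>The Palm measure is a mixture: weight each point of \<open>\<mm> \<omega>\<close> by \<open>w / \<gamma>\<close> and
    push it to the configuration \<open>\<theta> (- x) \<omega>\<close> seen from that point.\<close>
  define \<kappa> where "\<kappa> \<omega> = distr (density (\<mm> \<omega>) (\<lambda>x. ennreal (w x) / \<gamma>)) P (\<lambda>x. \<theta> (- x) \<omega>)" for \<omega>
  have \<kappa>: "emeasure (\<kappa> \<omega>) A = (\<integral>\<^sup>+x. indicator A (\<theta> (- x) \<omega>) * ennreal (w x) \<partial>\<mm> \<omega>) / \<gamma>"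
    if \<omega>: "\<omega> \<in> space P" and A [measurable]: "A \<in> sets P" for A \<omega>
  proof -
    note [measurable_cong] = sets_process[OF \<omega>]
    have [measurable]: "(\<lambda>x. \<theta> (- x) \<omega>) \<in> borel \<rightarrow>\<^sub>M P" using \<omega> by measurable
    have "emeasure (\<kappa> \<omega>) A = (\<integral>\<^sup>+z. indicator A z \<partial>\<kappa> \<omega>)"
      by (simp add: \<kappa>_def)
    also have "\<dots> = (\<integral>\<^sup>+x. indicator A (\<theta> (- x) \<omega>) \<partial>density (\<mm> \<omega>) (\<lambda>x. ennreal (w x) / \<gamma>))"
      unfolding \<kappa>_def by (rule nn_integral_distr) measurable
    also have "\<dots> = (\<integral>\<^sup>+x. ennreal (w x) / \<gamma> * indicator A (\<theta> (- x) \<omega>) \<partial>\<mm> \<omega>)"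
      by (rule nn_integral_density) measurable
    also have "\<dots> = (\<integral>\<^sup>+x. indicator A (\<theta> (- x) \<omega>) * ennreal (w x) / \<gamma> \<partial>\<mm> \<omega>)"
      by (intro nn_integral_cong) (simp add: divide_ennreal_def ac_simps)
    also have "\<dots> = (\<integral>\<^sup>+x. indicator A (\<theta> (- x) \<omega>) * ennreal (w x) \<partial>\<mm> \<omega>) / \<gamma>"
      by (rule nn_integral_divide) measurable
    finally show ?thesis .
  qed
  have int: "(\<integral>\<^sup>+\<omega>. emeasure (\<kappa> \<omega>) A \<partial>P)
    = (\<integral>\<^sup>+\<omega>. \<integral>\<^sup>+x. indicator A (\<theta> (- x) \<omega>) * ennreal (w x) \<partial>\<mm> \<omega> \<partial>P) / \<gamma>"
    if [measurable]: "A \<in> sets P" for A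
  proof -
    have "(\<integral>\<^sup>+\<omega>. emeasure (\<kappa> \<omega>) A \<partial>P)
      = (\<integral>\<^sup>+\<omega>. (\<integral>\<^sup>+x. indicator A (\<theta> (- x) \<omega>) * ennreal (w x) \<partial>\<mm> \<omega>) / \<gamma> \<partial>P)"
      by (intro nn_integral_cong \<kappa> that)
    also have "\<dots> = (\<integral>\<^sup>+\<omega>. \<integral>\<^sup>+x. indicator A (\<theta> (- x) \<omega>) * ennreal (w x) \<partial>\<mm> \<omega> \<partial>P) / \<gamma>"
      by (rule nn_integral_divide) measurable
    finally show ?thesis .
  qed
  have "palm_measure P \<theta> \<mm> \<gamma> w = measure_of (space P) (sets P) (\<lambda>A. \<integral>\<^sup>+\<omega>. emeasure (\<kappa> \<omega>) A \<partial>P)"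
    unfolding palm_measure_def
    by (intro measure_of_eq sets.space_closed) (simp add: int sets.sigma_sets_eq)
  also have "emeasure \<dots> A = (\<integral>\<^sup>+\<omega>. emeasure (\<kappa> \<omega>) A \<partial>P)"
  proof (rule emeasure_mixture)
    show "sets (\<kappa> \<omega>) = sets P" for \<omega> by (simp add: \<kappa>_def)
    fix A assume [measurable]: "A \<in> sets P"
    have "(\<lambda>\<omega>. (\<integral>\<^sup>+x. indicator A (\<theta> (- x) \<omega>) * ennreal (w x) \<partial>\<mm> \<omega>) / \<gamma>) \<in> borel_measurable P"
      by measurable
    then show "(\<lambda>\<omega>. emeasure (\<kappa> \<omega>) A) \<in> borel_measurable P"
      by (rule measurable_cong[THEN iffD1, rotated]) (simp add: \<kappa>)
  qed (rule A)
  also have "\<dots> = (\<integral>\<^sup>+\<omega>. \<integral>\<^sup>+x. indicator A (\<theta> (- x) \<omega>) * ennreal (w x) \<partial>\<mm> \<omega> \<partial>P) / \<gamma>"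
    by (rule int) (rule A)
  finally show ?thesis .
qed

lemma sets_palm_measure [measurable_cong]: "sets (palm_measure P \<theta> \<mm> \<gamma> w) = sets P"
  by (simp add: palm_measure_def)

lemma space_palm_measure: "space (palm_measure P \<theta> \<mm> \<gamma> w) = space P"
  by (simp add: palm_measure_def)

text \<open>\<open>\<mm> (\<theta> (- x) \<omega>)\<close> has an atom at the neutral element exactly if \<open>x\<close> is an atom of \<open>\<mm> \<omega>\<close>, and
\<open>\<mm> \<omega>\<close>-almost every \<open>x\<close> is an atom.\<close>

lemma AE_palm_neutral_point:
  assumes w [measurable]: "w \<in> borel_measurable borel"
  shows "AE \<omega> in palm_measure P \<theta> \<mm> \<gamma> w. emeasure (\<mm> \<omega>) {0} = 1"
proof -
  define A where "A = {\<omega> \<in> space P. emeasure (\<mm> \<omega>) {0} = 0}"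
  have A [measurable]: "A \<in> sets P" unfolding A_def by measurable
  have "(\<integral>\<^sup>+\<omega>. \<integral>\<^sup>+x. indicator A (\<theta> (- x) \<omega>) * ennreal (w x) \<partial>\<mm> \<omega> \<partial>P) = (\<integral>\<^sup>+\<omega>. 0 \<partial>P)"
  proof (rule nn_integral_cong)
    fix \<omega> assume \<omega>: "\<omega> \<in> space P"
    have "AE x in \<mm> \<omega>. x \<notin> - points (\<mm> \<omega>)"
      by (intro AE_not_in simple_counting_measure_diffuse_null locally_compact counting \<omega>)
    then have "AE x in \<mm> \<omega>. indicator A (\<theta> (- x) \<omega>) * ennreal (w x) = 0"
      by eventually_elim (simp add: A_def points_def emeasure_process_shift_singleton \<omega>)
    then have "(\<integral>\<^sup>+x. indicator A (\<theta> (- x) \<omega>) * ennreal (w x) \<partial>\<mm> \<omega>) = (\<integral>\<^sup>+x. 0 \<partial>\<mm> \<omega>)"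
      by (rule nn_integral_cong_AE)
    then show "(\<integral>\<^sup>+x. indicator A (\<theta> (- x) \<omega>) * ennreal (w x) \<partial>\<mm> \<omega>) = 0" by simp
  qed
  then have "A \<in> null_sets (palm_measure P \<theta> \<mm> \<gamma> w)"
    by (simp add: null_sets_def emeasure_palm_measure sets_palm_measure)
  from AE_not_in[OF this] show ?thesis
  proof (rule AE_mp, intro AE_I2 impI)
    fix \<omega> assume "\<omega> \<in> space (palm_measure P \<theta> \<mm> \<gamma> w)" "\<omega> \<notin> A"
    then have \<omega>: "\<omega> \<in> space P" and "emeasure (\<mm> \<omega>) {0} \<noteq> 0"
      by (auto simp: A_def space_palm_measure)
    moreover have "emeasure (\<mm> \<omega>) {0} = \<infinity> \<or> (\<exists>n::nat. emeasure (\<mm> \<omega>) {0} = of_nat n)"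
      and "emeasure (\<mm> \<omega>) {0} \<le> 1"
      using counting[OF \<omega>] by (simp_all add: simple_counting_measure_def)
    ultimately show "emeasure (\<mm> \<omega>) {0} = 1"
      by (auto simp: top_unique)
  qed
qed

lemma emeasure_process_off_neutral:
  assumes "\<omega> \<in> space P" "B \<in> sets borel"
  shows "emeasure (density (\<mm> \<omega>) (indicator (- {0}))) B = emeasure (\<mm> \<omega>) (B - {0})"
  using assms by (subst emeasure_restricted) (auto simp: sets_process intro!: arg_cong2[where f=emeasure])

text \<open>Without the assumption on the neutral element, the difference of set functions that defines the
reduced process can fail to be a measure.\<close>

lemma reduced_process_eq_density:
  assumes \<omega>: "\<omega> \<in> space P" and 0: "emeasure (\<mm> \<omega>) {0} = 1"
  shows "reduced_process \<mm> \<omega> = density (\<mm> \<omega>) (indicator (- {0}))"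
proof -
  note [measurable_cong] = sets_process[OF \<omega>]
  have eq: "emeasure (\<mm> \<omega>) B - emeasure (return borel 0) B = emeasure (density (\<mm> \<omega>) (indicator (- {0}))) B"
    if B: "B \<in> sets borel" for B :: "'a set"
  proof -
    have "emeasure (\<mm> \<omega>) B = emeasure (\<mm> \<omega>) (B - {0}) + emeasure (return borel 0) B"
    proof (cases "0 \<in> B")
      case True
      have "emeasure (\<mm> \<omega>) ((B - {0}) \<union> {0}) = emeasure (\<mm> \<omega>) (B - {0}) + emeasure (\<mm> \<omega>) {0}"
        using B by (intro plus_emeasure[symmetric]) (auto simp: sets_process \<omega>)
      with True B show ?thesis by (simp add: 0 insert_absorb)
    qed (use B in simp)
    moreover have "emeasure (return borel 0) B \<noteq> top" using B by (simp add: indicator_def)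
    ultimately show ?thesis
      using B \<omega> by (simp add: emeasure_process_off_neutral ennreal_add_diff_cancel_right)
  qed
  have "reduced_process \<mm> \<omega> = measure_of (space (\<mm> \<omega>)) (sets (\<mm> \<omega>))
      (emeasure (density (\<mm> \<omega>) (indicator (- {0}))))"
    unfolding reduced_process_def diff_measure_def
    by (intro measure_of_eq sets.space_closed) (simp add: eq sets_process space_process \<omega> sets.sigma_sets_eq[of "borel :: 'a measure", simplified]
      del: emeasure_return)
  also have "\<dots> = density (\<mm> \<omega>) (indicator (- {0}))"
    using measure_of_of_measure[of "density (\<mm> \<omega>) (indicator (- {0}))"] by simp
  finally show ?thesis .
qed

text \<open>The configurations for which the reduced process is not the restriction of \<open>\<mm> \<omega>\<close> to the complement
of the neutral element form a Palm null set, so they do not affect the mean.\<close>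

lemma emeasure_mean_reduced_palm:
  assumes w: "w \<in> borel_measurable borel" and B: "B \<in> sets borel"
  shows "emeasure (mean_measure (palm_measure P \<theta> \<mm> \<gamma> w) (reduced_process \<mm>)) B
    = (\<integral>\<^sup>+\<omega>. emeasure (\<mm> \<omega>) (B - {0}) \<partial>palm_measure P \<theta> \<mm> \<gamma> w)"
proof -
  let ?Q = "palm_measure P \<theta> \<mm> \<gamma> w"
  let ?\<kappa> = "\<lambda>\<omega>. density (\<mm> \<omega>) (indicator (- {0}))"
  have "(\<integral>\<^sup>+\<omega>. emeasure (reduced_process \<mm> \<omega>) A \<partial>?Q) = (\<integral>\<^sup>+\<omega>. emeasure (?\<kappa> \<omega>) A \<partial>?Q)" for A
    by (intro nn_integral_cong_AE AE_mp[OF AE_palm_neutral_point[OF w] AE_I2] impI)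
       (simp add: reduced_process_eq_density space_palm_measure)
  then have "mean_measure ?Q (reduced_process \<mm>)
    = measure_of (space borel) (sets borel) (\<lambda>A. \<integral>\<^sup>+\<omega>. emeasure (?\<kappa> \<omega>) A \<partial>?Q)"
    by (simp add: mean_measure_def)
  also have "emeasure \<dots> B = (\<integral>\<^sup>+\<omega>. emeasure (?\<kappa> \<omega>) B \<partial>?Q)"
  proof (rule emeasure_mixture)
    show "sets (?\<kappa> \<omega>) = sets borel" if "\<omega> \<in> space ?Q" for \<omega>
      using that by (simp add: sets_process space_palm_measure)
    fix A :: "'a set" assume A [measurable]: "A \<in> sets borel"
    have "(\<lambda>\<omega>. emeasure (\<mm> \<omega>) (A - {0})) \<in> borel_measurable ?Q" by measurable
    then show "(\<lambda>\<omega>. emeasure (?\<kappa> \<omega>) A) \<in> borel_measurable ?Q"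
      by (rule measurable_cong[THEN iffD1, rotated]) (simp add: emeasure_process_off_neutral A space_palm_measure)
  qed (rule B)
  also have "\<dots> = (\<integral>\<^sup>+\<omega>. emeasure (\<mm> \<omega>) (B - {0}) \<partial>?Q)"
    by (intro nn_integral_cong emeasure_process_off_neutral B) (simp add: space_palm_measure)
  finally show ?thesis .
qed

section \<open>Separation of points\<close>

text \<open>Take for \<open>E\<close> the coincidences with nonzero displacement: distinct points \<open>X\<close> and \<open>Y\<close> with \<open>f X = f Y\<close>
satisfy \<open>(X, - X + Y) \<in> E\<close>.  The exceptional set \<open>Z\<close> of displacements is empty under the pointwise
hypothesis and a null set of the reduced Palm mean under the other one.  Either way the Palm
expectation of the number of points in \<open>Z\<close> is zero, which is what the lemma on related points asks
for.\<close>

lemma separates_points_of_if_null_coincidences: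
  assumes w [measurable]: "w \<in> borel_measurable borel" and w_pos: "(\<integral>\<^sup>+x. ennreal (w x) \<partial>haar) \<noteq> 0"
    and \<gamma>: "\<gamma> \<noteq> \<infinity>"
    and f: "measurable_coincidences f"
    and null: "(\<forall>y. y \<noteq> 0 \<longrightarrow> emeasure haar {x. f x = f (x + y)} = 0) \<or>
      (AE y in mean_measure (palm_measure P \<theta> \<mm> \<gamma> w) (reduced_process \<mm>).
         emeasure haar {x. f x = f (x + y)} = 0)"
  shows "separates_points_of f P \<mm>"
proof -
  interpret haar: sigma_finite_measure haar by (rule sigma_finite_haar)
  let ?Q = "palm_measure P \<theta> \<mm> \<gamma> w"
  let ?M = "mean_measure ?Q (reduced_process \<mm>)"
  define C where "C = {(x, y). f x = f (x + y)}"
  have C [measurable]: "C \<in> sets (borel \<Otimes>\<^sub>M borel)"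
    using f by (simp add: C_def measurable_coincidences_def)
  define E where "E = C \<inter> {p \<in> space (borel \<Otimes>\<^sub>M borel). snd p \<noteq> 0}"
  have E [measurable]: "E \<in> sets (borel \<Otimes>\<^sub>M borel)"
    unfolding E_def by measurable
  define Z where "Z = {y. (\<integral>\<^sup>+x. indicator E (x, y) \<partial>haar) \<noteq> 0}"
  have Z_sets [measurable]: "Z \<in> sets borel"
  proof -
    have "{y \<in> space borel. (\<integral>\<^sup>+x. indicator E (x, y) \<partial>haar) \<noteq> 0} \<in> sets borel" by measurable
    then show ?thesis by (simp add: Z_def)
  qed
  have section_C: "{x. f x = f (x + y)} \<in> sets borel" for y
    using sets_Pair2[OF C, of y] by (simp add: C_def vimage_def)
  have Z_eq: "Z = {y. y \<noteq> 0 \<and> emeasure haar {x. f x = f (x + y)} \<noteq> 0}"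
  proof -
    have "(\<integral>\<^sup>+x. indicator E (x, y) \<partial>haar) = (if y = 0 then 0 else emeasure haar {x. f x = f (x + y)})" for y
    proof (cases "y = 0")
      case False
      have "(\<integral>\<^sup>+x. indicator E (x, y) \<partial>haar) = (\<integral>\<^sup>+x. indicator {x. f x = f (x + y)} x \<partial>haar)"
        using False by (intro nn_integral_cong) (simp add: E_def C_def indicator_def space_pair_measure)
      with False section_C show ?thesis by (simp add: sets_haar)
    qed (simp add: E_def)
    then show ?thesis by (auto simp: Z_def)
  qed
  define A where "A = {\<omega> \<in> space P. emeasure (\<mm> \<omega>) Z \<noteq> 0}"
  have A [measurable]: "A \<in> sets P" unfolding A_def by measurable
  have "emeasure ?M Z = 0"
    using null
  proof
    assume "\<forall>y. y \<noteq> 0 \<longrightarrow> emeasure haar {x. f x = f (x + y)} = 0"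
    then have "Z = {}" by (auto simp: Z_eq)
    then show ?thesis by simp
  next
    assume "AE y in ?M. emeasure haar {x. f x = f (x + y)} = 0"
    then obtain N where N: "N \<in> null_sets ?M" "{y\<in>space ?M. emeasure haar {x. f x = f (x + y)} \<noteq> 0} \<subseteq> N"
      by (auto elim!: AE_E simp: null_sets_def)
    have "space ?M = UNIV" by (simp add: mean_measure_def)
    with N(2) have "Z \<subseteq> N" by (auto simp: Z_eq)
    with N(1) show ?thesis
      using emeasure_mono[of Z N ?M] by (auto simp: null_sets_def)
  qed
  moreover have "Z - {0} = Z" by (auto simp: Z_eq)
  ultimately have "(\<integral>\<^sup>+\<omega>. emeasure (\<mm> \<omega>) Z \<partial>?Q) = 0"
    using emeasure_mean_reduced_palm[OF w Z_sets, of \<gamma>] by simp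
  then have "emeasure ?Q {\<omega> \<in> space ?Q. emeasure (\<mm> \<omega>) Z \<noteq> 0} = 0"
    by (subst (asm) nn_integral_0_iff) measurable
  then have "(\<integral>\<^sup>+\<omega>. \<integral>\<^sup>+x. indicator A (\<theta> (- x) \<omega>) * ennreal (w x) \<partial>\<mm> \<omega> \<partial>P) = 0"
    using \<gamma> emeasure_palm_measure[OF w A, of \<gamma>] by (simp add: space_palm_measure A_def)
  from AE_no_related_points[OF E _ w_pos Z_def A_def this]
  have "AE \<omega> in P. \<forall>X\<in>points (\<mm> \<omega>). \<forall>Y\<in>points (\<mm> \<omega>). (X, - X + Y) \<notin> E"
    by simp
  then show ?thesis
    unfolding separates_points_of_def
  proof eventually_elim
    case (elim \<omega>)
    show ?case
    proof
      assume "\<exists>X\<in>points (\<mm> \<omega>). \<exists>Y\<in>points (\<mm> \<omega>). X \<noteq> Y \<and> f X = f Y"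
      then obtain X Y where XY: "X \<in> points (\<mm> \<omega>)" "Y \<in> points (\<mm> \<omega>)" "X \<noteq> Y" "f X = f Y" by blast
      have "- X + Y \<noteq> 0"
        using XY(3) by (metis add.right_neutral add_minus_cancel)
      with XY(4) have "(X, - X + Y) \<in> E"
        by (simp add: E_def C_def space_pair_measure add.assoc[symmetric])
      with elim XY show False by blast
    qed
  qed
qed

end



theorem corollary4p12:
  fixes haar :: "'a::{topological_group_add, second_countable_topology, t2_space} measure"
    and P :: "'w measure"
    and \<theta> :: "'a \<Rightarrow> 'w \<Rightarrow> 'w"
    and \<mm> :: "'w \<Rightarrow> 'a measure"
    and B :: "'a set"
    and \<gamma> :: ennreal
    and w :: "'a \<Rightarrow> real"
    and S :: "'s measure"
    and f :: "'a \<Rightarrow> 's"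
  assumes "locally_compact_space (euclidean :: 'a topology)"
    and "left_Haar_measure haar"
    and "stationary_framework P \<theta>"
    and "simple_point_process P \<mm>"
    and "flow_adapted P \<theta> \<mm>"
    and "B \<in> sets borel" and "0 < emeasure haar B" and "emeasure haar B < \<infinity>"
    and "\<gamma> = intensity P haar \<mm> B" and "0 < \<gamma>" and "\<gamma> < \<infinity>"
    and "w \<in> borel_measurable borel" and "\<And>x. 0 \<le> w x" and "(\<integral>\<^sup>+x. ennreal (w x) \<partial>haar) = 1"
    and "f \<in> borel \<rightarrow>\<^sub>M S"
  shows "(measurable_coincidences f \<and>
           ((\<forall>y. y \<noteq> 0 \<longrightarrow> emeasure haar {x. f x = f (x + y)} = 0) \<or>
            (AE y in mean_measure (palm_measure P \<theta> \<mm> \<gamma> w) (reduced_process \<mm>).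
               emeasure haar {x. f x = f (x + y)} = 0))
           \<longrightarrow> separates_points_of f P \<mm>) \<and>
         (measurable_diagonal S \<longrightarrow>
            measurable_coincidences f \<and> (\<forall>y. {x. f x = f (x + y)} \<in> sets borel)) \<and>
         (standard_measurable_space S \<longrightarrow> measurable_diagonal S)"
proof -
  interpret stationary_point_process haar P \<theta> \<mm>
    using assms by unfold_locales
  have "(\<integral>\<^sup>+x. ennreal (w x) \<partial>haar) \<noteq> 0"
    using assms by simp
  then have "separates_points_of f P \<mm>"
    if "measurable_coincidences f"
      and "(\<forall>y. y \<noteq> 0 \<longrightarrow> emeasure haar {x. f x = f (x + y)} = 0) \<or>
        (AE y in mean_measure (palm_measure P \<theta> \<mm> \<gamma> w) (reduced_process \<mm>).
           emeasure haar {x. f x = f (x + y)} = 0)"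
    using assms that by (intro separates_points_of_if_null_coincidences) auto
  moreover have "{x. f x = f (x + y)} \<in> sets borel" if "measurable_coincidences f" for y
    using that unfolding measurable_coincidences_def
    by (auto dest: sets_Pair2[where y=y] simp: vimage_def)
  ultimately show ?thesis
    using measurable_coincidences_of_diagonal[of f S] measurable_diagonal_standard[of S] assms by blast
qed

end
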